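(* Let $\mathcal{G}=(V,\mathcal{I},\mathcal{E},\partial)$ be a finite connected non-compact graph without tadpoles, with lengths $\underline{a}=\{a_i\}_{i\in\mathcal{I}}$, $a_i>0$, of the internal lines, and let $\mathcal{M}=\{M(v)\}_{v\in V}$ be an arbitrary collection of complex $\deg(v)\times\deg(v)$ matrices at the vertices. Let $\mathcal{D}\subset\mathbb{C}$ be the set of zeros of the entire function $\det D(\beta)$ (a discrete set without accumulation points in $\mathbb{C}$). Then the generating function $T(\beta)=\left(T_{e,e'}(\beta)\right)_{e,e'\in\mathcal{E}}$, defined for $\mathrm{Re}\,\beta$ sufficiently large by the convergent series $T_{e,e'}(\beta)=\sum_{\mathbf{w}\in\mathcal{W}_{e,e'}}W(\mathbf{w})\,e^{-\beta|\mathbf{w}|}$, has an analytic extension to $\mathbb{C}\setminus\mathcal{D}$, and $$T(\beta)=\begin{pmatrix}\mathbb{I}&0&0\end{pmatrix}D(\beta)^{-1}\,\mathbf{M}\begin{pmatrix}\mathbb{I}\\0\\0\end{pmatrix}.$$ Here the block vectors refer to the decomposition $\mathcal{K}=\mathcal{K}_{\mathcal{E}}\oplus\mathcal{K}_{\mathcal{I}}^{(-)}\oplus\mathcal{K}_{\mathcal{I}}^{(+)}$.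
   Context: **Graph.** $V$ is a finite set of vertices, $\mathcal{I}$ a finite set of internal lines, $\mathcal{E}$ a finite nonempty set of external lines. $\partial$ assigns to each $i\in\mathcal{I}$ an ordered pair $(\partial^-(i),\partial^+(i))$ of vertices (initial and terminal vertex), and to each $e\in\mathcal{E}$ a single vertex $\partial(e)$. No tadpoles: $\partial^-(i)\neq\partial^+(i)$. Multiple lines between two vertices, and several external lines at one vertex, are allowed. A vertex $v$ and a line $j$ are incident if $v\in\partial(j)$; $\mathcal{S}(v)\subset\mathcal{E}\cup\mathcal{I}$ is the set of lines incident with $v$ and $\deg(v)=|\mathcal{S}(v)|$. The matrix $M(v)$ has entries $[M(v)]_{j_1,j_2}$ indexed by $j_1,j_2\in\mathcal{S}(v)$. **Walks.** A nontrivial walk from $e'\in\mathcal{E}$ to $e\in\mathcal{E}$ is a sequence $\mathbf{w}=\{e',i_1,\dots,i_N,e\}$, $N\ge1$, $i_p\in\mathcal{I}$, for which there are vertices $v_0,\dots,v_N$ with $v_0=\partial(e')\in\partial(i_1)$, $v_N=\partial(e)\in\partial(i_N)$, $v_p\in\partial(i_p)\cap\partial(i_{p+1})$ for $1\le p\le N-1$, and $v_p\ne v_{p+1}$ for $0\le p\le N-1$ (these vertices are unique). A trivial walk is $\{e',e\}$ with $\partial(e)=\partial(e')$. $\mathcal{W}_{e,e'}$ is the set of all walks from $e'$ to $e$. The metric length is $|\mathbf{w}|=\sum_{p=1}^N a_{i_p}$ (zero for a trivial walk). The weight is $W(\mathbf{w})=[M(v_N)]_{e,i_N}\prod_{p=1}^{N-1}[M(v_p)]_{i_{p+1},i_p}\,[M(v_0)]_{i_1,e'}$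 for a nontrivial walk and $W(\mathbf{w})=[M(\partial(e))]_{e,e'}$ for a trivial one. **Matrices.** $\mathcal{K}=\mathcal{K}_{\mathcal{E}}\oplus\mathcal{K}_{\mathcal{I}}^{(-)}\oplus\mathcal{K}_{\mathcal{I}}^{(+)}$ with $\mathcal{K}_{\mathcal{E}}\cong\mathbb{C}^{|\mathcal{E}|}$, $\mathcal{K}_{\mathcal{I}}^{(\pm)}\cong\mathbb{C}^{|\mathcal{I}|}$. Each canonical basis vector $h$ of $\mathcal{K}$ corresponds to an edge $j(h)$ and a vertex $v(h)$: $v(h)=\partial(j(h))$ if $h\in\mathcal{K}_{\mathcal{E}}$, $v(h)=\partial^-(j(h))$ if $h\in\mathcal{K}_{\mathcal{I}}^{(-)}$, $v(h)=\partial^+(j(h))$ if $h\in\mathcal{K}_{\mathcal{I}}^{(+)}$. The linear map $\mathbf{M}$ on $\mathcal{K}$ is given by $\langle h_1,\mathbf{M}h_2\rangle=[M(v(h_1))]_{j(h_1),j(h_2)}$ if $v(h_1)=v(h_2)$, and $0$ otherwise. With $e^{\pm\beta\underline{a}}$ the diagonal $|\mathcal{I}|\times|\mathcal{I}|$ matrices with entries $e^{\pm\beta a_i}$, put $$X=\begin{pmatrix}\mathbb{I}&0&0\\0&\mathbb{I}&\mathbb{I}\\0&e^{-\beta\underline{a}}&e^{\beta\underline{a}}\end{pmatrix},\qquad Y=\begin{pmatrix}\mathbb{I}&0&0\\0&\mathbb{I}&-\mathbb{I}\\0&-e^{-\beta\underline{a}}&e^{\beta\underline{a}}\end{pmatrix},\qquad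 D(\beta)=\tfrac12(X+Y)-\tfrac12\mathbf{M}(X-Y).$$ *)

theory Defs
  imports "HOL-Analysis.Analysis"
    "Jordan_Normal_Form.Determinant"
    "Jordan_Normal_Form.Gauss_Jordan_Elimination"
begin

section \<open>Graphs with internal and external lines\<close>

record ('v, 'l) line_graph =
  verts :: "'v set"
  internal :: "'l set"
  external :: "'l set"
  bd_int :: "'l \<Rightarrow> 'v \<times> 'v"  \<comment> \<open>(initial vertex, terminal vertex) of an internal line\<close>
  bd_ext :: "'l \<Rightarrow> 'v"

definition wf_graph :: "('v, 'l) line_graph \<Rightarrow> bool" where
  "wf_graph G \<longleftrightarrow>
     finite (verts G) \<and> finite (internal G) \<and> finite (external G) \<and>
     internal G \<inter> external G = {} \<and>
     (\<forall>i\<in>internal G. fst (bd_int G i) \<in> verts G \<and> snd (bd_int G i) \<in> verts G) \<and>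
     (\<forall>e\<in>external G. bd_ext G e \<in> verts G)"

definition no_tadpoles :: "('v, 'l) line_graph \<Rightarrow> bool" where
  "no_tadpoles G \<longleftrightarrow> (\<forall>i\<in>internal G. fst (bd_int G i) \<noteq> snd (bd_int G i))"

definition int_ends :: "('v, 'l) line_graph \<Rightarrow> 'l \<Rightarrow> 'v set" where
  "int_ends G i = {fst (bd_int G i), snd (bd_int G i)}"

definition adjacent :: "('v, 'l) line_graph \<Rightarrow> ('v \<times> 'v) set" where
  "adjacent G = {(u, v). \<exists>i\<in>internal G. int_ends G i = {u, v}}"

definition connected_graph :: "('v, 'l) line_graph \<Rightarrow> bool" where
  "connected_graph G \<longleftrightarrow> (\<forall>u\<in>verts G. \<forall>v\<in>verts G. (u, v) \<in> (adjacent G)\<^sup>*)"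

definition noncompact_graph :: "('v, 'l) line_graph \<Rightarrow> bool" where
  "noncompact_graph G \<longleftrightarrow> external G \<noteq> {}"


section \<open>Walks\<close>

text \<open>
  A walk \<open>{e', i\<^sub>1, \<dots>, i\<^sub>N, e}\<close> is the list \<open>w\<close> of length \<open>N + 2\<close> with
  \<open>w ! 0 = e'\<close>, \<open>w ! p = i\<^sub>p\<close> for \<open>1 \<le> p \<le> N\<close> and \<open>w ! (N + 1) = e\<close>.
  The list \<open>vs\<close> below is the vertex sequence \<open>v\<^sub>0, \<dots>, v\<^sub>N\<close>.
\<close>

definition walk_vertices :: "('v, 'l) line_graph \<Rightarrow> 'l list \<Rightarrow> 'v list \<Rightarrow> bool" where
  "walk_vertices G w vs \<longleftrightarrow>
     (\<exists>N\<ge>1. length w = N + 2 \<and> length vs = N + 1 \<and>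
        vs ! 0 = bd_ext G (w ! 0) \<and> vs ! 0 \<in> int_ends G (w ! 1) \<and>
        vs ! N = bd_ext G (w ! (N + 1)) \<and> vs ! N \<in> int_ends G (w ! N) \<and>
        (\<forall>p\<in>{1..N - 1}. vs ! p \<in> int_ends G (w ! p) \<inter> int_ends G (w ! (p + 1))) \<and>
        (\<forall>p<N. vs ! p \<noteq> vs ! (p + 1)))"

definition nontrivial_walk :: "('v, 'l) line_graph \<Rightarrow> 'l \<Rightarrow> 'l \<Rightarrow> 'l list \<Rightarrow> bool" where
  "nontrivial_walk G e e' w \<longleftrightarrow>
     e' \<in> external G \<and> e \<in> external G \<and>
     (\<exists>ks. ks \<noteq> [] \<and> set ks \<subseteq> internal G \<and> w = e' # ks @ [e]) \<and>
     (\<exists>vs. walk_vertices G w vs)"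

definition trivial_walk :: "('v, 'l) line_graph \<Rightarrow> 'l \<Rightarrow> 'l \<Rightarrow> 'l list \<Rightarrow> bool" where
  "trivial_walk G e e' w \<longleftrightarrow>
     e' \<in> external G \<and> e \<in> external G \<and> bd_ext G e = bd_ext G e' \<and> w = [e', e]"

text \<open>As in \<open>T\<^sub>e\<^sub>,\<^sub>e\<^sub>'\<close>, the target \<open>e\<close> is the first index and the starting line \<open>e'\<close> the second.\<close>

definition walks :: "('v, 'l) line_graph \<Rightarrow> 'l \<Rightarrow> 'l \<Rightarrow> 'l list set" where
  "walks G e e' = {w. nontrivial_walk G e e' w \<or> trivial_walk G e e' w}"

text \<open>The definite description in \<open>walk_weight\<close> below is justified by uniqueness of the vertices.\<close>

lemma walk_vertices_unique:
  assumes "walk_vertices G w vs" and "walk_vertices G w us"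
  shows "vs = us"
proof -
  obtain N where N: "length w = N + 2" "N \<ge> 1" "length vs = N + 1"
    and v0: "vs ! 0 = bd_ext G (w ! 0)" "vs ! 0 \<in> int_ends G (w ! 1)"
    and vN: "vs ! N \<in> int_ends G (w ! N)"
    and vp: "\<forall>p\<in>{1..N - 1}. vs ! p \<in> int_ends G (w ! p) \<inter> int_ends G (w ! (p + 1))"
    and vd: "\<forall>p<N. vs ! p \<noteq> vs ! (p + 1)"
    using assms(1) unfolding walk_vertices_def by auto
  have lu: "length us = N + 1"
    and u0: "us ! 0 = bd_ext G (w ! 0)" "us ! 0 \<in> int_ends G (w ! 1)"
    and uN: "us ! N \<in> int_ends G (w ! N)"
    and up: "\<forall>p\<in>{1..N - 1}. us ! p \<in> int_ends G (w ! p) \<inter> int_ends G (w ! (p + 1))"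
    and ud: "\<forall>p<N. us ! p \<noteq> us ! (p + 1)"
    using assms(2) N(1) unfolding walk_vertices_def by auto
  have "p \<le> N \<Longrightarrow> vs ! p = us ! p" for p
  proof (induction p)
    case 0
    then show ?case using v0 u0 by simp
  next
    case (Suc p)
    then have eq: "vs ! p = us ! p" and p: "p < N" by auto
    have a: "vs ! p \<in> int_ends G (w ! (p + 1))"
      using v0(2) vp p by (cases p) auto
    have b: "vs ! (p + 1) \<in> int_ends G (w ! (p + 1))"
      using vN vp p by (cases "p + 1 = N") auto
    have c: "us ! (p + 1) \<in> int_ends G (w ! (p + 1))"
      using uN up p by (cases "p + 1 = N") auto
    have "vs ! p \<noteq> vs ! (p + 1)" "us ! p \<noteq> us ! (p + 1)" using vd ud p by auto
    with a b c eq show ?case unfolding int_ends_def by auto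
  qed
  then show ?thesis using N(3) lu by (intro nth_equalityI) auto
qed

definition walk_length :: "('l \<Rightarrow> real) \<Rightarrow> 'l list \<Rightarrow> real" where
  "walk_length a w = (\<Sum>p = 1..length w - 2. a (w ! p))"

text \<open>
  \<open>M v j\<^sub>1 j\<^sub>2\<close> is the entry \<open>[M(v)]\<close> with row \<open>j\<^sub>1\<close> and column \<open>j\<^sub>2\<close>.  Only its values at
  lines \<open>j\<^sub>1\<close>, \<open>j\<^sub>2\<close> incident with \<open>v\<close> enter below, so \<open>M\<close> encodes an arbitrary family of
  \<open>deg(v) \<times> deg(v)\<close> matrices.
\<close>

definition walk_weight ::
  "('v, 'l) line_graph \<Rightarrow> ('v \<Rightarrow> 'l \<Rightarrow> 'l \<Rightarrow> complex) \<Rightarrow> 'l list \<Rightarrow> complex" where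
  "walk_weight G M w =
     (let N = length w - 2; vs = (THE vs. walk_vertices G w vs) in
      if N = 0 then M (bd_ext G (w ! 1)) (w ! 1) (w ! 0)
      else M (vs ! N) (w ! (N + 1)) (w ! N) *
           (\<Prod>p = 1..N - 1. M (vs ! p) (w ! (p + 1)) (w ! p)) *
           M (vs ! 0) (w ! 1) (w ! 0))"

definition walk_term ::
  "('v, 'l) line_graph \<Rightarrow> ('l \<Rightarrow> real) \<Rightarrow> ('v \<Rightarrow> 'l \<Rightarrow> 'l \<Rightarrow> complex) \<Rightarrow> complex \<Rightarrow> 'l list \<Rightarrow> complex"
  where "walk_term G a M \<beta> w = walk_weight G M w * exp (- \<beta> * of_real (walk_length a w))"


section \<open>Matrices on \<open>\<K> = \<K>\<^sub>E \<oplus> \<K>\<^sub>I\<^sup>(\<^sup>-\<^sup>) \<oplus> \<K>\<^sub>I\<^sup>(\<^sup>+\<^sup>)\<close>\<close>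

text \<open>
  The canonical basis of \<open>\<K>\<close> is ordered by enumerations \<open>es\<close> of the external and \<open>ls\<close> of the
  internal lines: with \<open>n = length es\<close> and \<open>m = length ls\<close>, the indices \<open>k < n\<close> belong to
  \<open>\<K>\<^sub>E\<close>, \<open>n \<le> k < n + m\<close> to \<open>\<K>\<^sub>I\<^sup>(\<^sup>-\<^sup>)\<close> and \<open>n + m \<le> k < n + 2m\<close> to \<open>\<K>\<^sub>I\<^sup>(\<^sup>+\<^sup>)\<close>.
  The functions \<open>basis_edge\<close>, \<open>basis_vertex\<close> are \<open>j(h)\<close> and \<open>v(h)\<close>.
\<close>

definition basis_edge :: "'l list \<Rightarrow> 'l list \<Rightarrow> nat \<Rightarrow> 'l" where
  "basis_edge es ls k = (es @ ls @ ls) ! k"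

definition basis_vertex :: "('v, 'l) line_graph \<Rightarrow> 'l list \<Rightarrow> 'l list \<Rightarrow> nat \<Rightarrow> 'v" where
  "basis_vertex G es ls k =
     (if k < length es then bd_ext G (basis_edge es ls k)
      else if k < length es + length ls then fst (bd_int G (basis_edge es ls k))
      else snd (bd_int G (basis_edge es ls k)))"

definition big_M ::
  "('v, 'l) line_graph \<Rightarrow> ('v \<Rightarrow> 'l \<Rightarrow> 'l \<Rightarrow> complex) \<Rightarrow> 'l list \<Rightarrow> 'l list \<Rightarrow> complex Matrix.mat" where
  "big_M G M es ls =
     Matrix.mat (length es + (length ls + length ls)) (length es + (length ls + length ls))
       (\<lambda>(h1, h2).
          if basis_vertex G es ls h1 = basis_vertex G es ls h2
          then M (basis_vertex G es ls h1) (basis_edge es ls h1) (basis_edge es ls h2)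
          else 0)"

text \<open>The diagonal matrix of the numbers \<open>exp (s * a\<^sub>i)\<close>, used for \<open>s = \<beta>\<close> and \<open>s = - \<beta>\<close>.\<close>

definition exp_diag :: "('l \<Rightarrow> real) \<Rightarrow> 'l list \<Rightarrow> complex \<Rightarrow> complex Matrix.mat" where
  "exp_diag a ls s = mat_diag (length ls) (\<lambda>k. exp (s * of_real (a (ls ! k))))"

definition X_mat :: "('l \<Rightarrow> real) \<Rightarrow> 'l list \<Rightarrow> 'l list \<Rightarrow> complex \<Rightarrow> complex Matrix.mat" where
  "X_mat a es ls \<beta> = (let n = length es; m = length ls in
     four_block_mat
       (1\<^sub>m n) (0\<^sub>m n (m + m))
       (0\<^sub>m (m + m) n) (four_block_mat
                            (1\<^sub>m m) (1\<^sub>m m)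
                            (exp_diag a ls (- \<beta>)) (exp_diag a ls \<beta>)))"

definition Y_mat :: "('l \<Rightarrow> real) \<Rightarrow> 'l list \<Rightarrow> 'l list \<Rightarrow> complex \<Rightarrow> complex Matrix.mat" where
  "Y_mat a es ls \<beta> = (let n = length es; m = length ls in
     four_block_mat
       (1\<^sub>m n) (0\<^sub>m n (m + m))
       (0\<^sub>m (m + m) n) (four_block_mat
                            (1\<^sub>m m) (- 1\<^sub>m m)
                            (- exp_diag a ls (- \<beta>)) (exp_diag a ls \<beta>)))"

definition D_mat ::
  "('v, 'l) line_graph \<Rightarrow> ('l \<Rightarrow> real) \<Rightarrow> ('v \<Rightarrow> 'l \<Rightarrow> 'l \<Rightarrow> complex) \<Rightarrow>
   'l list \<Rightarrow> 'l list \<Rightarrow> complex \<Rightarrow> complex Matrix.mat" where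
  "D_mat G a M es ls \<beta> =
     (1/2) \<cdot>\<^sub>m (X_mat a es ls \<beta> + Y_mat a es ls \<beta>)
     - (1/2) \<cdot>\<^sub>m (big_M G M es ls * (X_mat a es ls \<beta> - Y_mat a es ls \<beta>))"

definition zero_set ::
  "('v, 'l) line_graph \<Rightarrow> ('l \<Rightarrow> real) \<Rightarrow> ('v \<Rightarrow> 'l \<Rightarrow> 'l \<Rightarrow> complex) \<Rightarrow>
   'l list \<Rightarrow> 'l list \<Rightarrow> complex set" where
  "zero_set G a M es ls = {\<beta>. Determinant.det (D_mat G a M es ls \<beta>) = 0}"

text \<open>The block column with blocks \<open>I, 0, 0\<close>; its transpose is the block row.\<close>

definition ext_column :: "'l list \<Rightarrow> 'l list \<Rightarrow> complex Matrix.mat" where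
  "ext_column es ls =
     1\<^sub>m (length es) @\<^sub>r 0\<^sub>m (length ls) (length es) @\<^sub>r 0\<^sub>m (length ls) (length es)"

end

theory Submission
  imports Defs "HOL-Complex_Analysis.Complex_Analysis"
begin

text \<open>
  Write \<open>D(\<beta>) = (1 - \<M> S) E\<close>, where \<open>E = (X + Y)/2\<close> is diagonal and \<open>S\<close> exchanges the two ends
  of every internal line \<open>i\<close> with weight \<open>exp (-\<beta> a\<^sub>i)\<close>; since \<open>E\<close> is the identity on
  \<open>\<K>\<^sub>E\<close>, the right-hand side of the formula is the compression of \<open>(1 - \<M> S)\<^sup>-\<^sup>1 \<M>\<close> to \<open>\<K>\<^sub>E\<close>.
  For a fixed starting line, let \<open>F(v, j)\<close> be the sum over all walks that arrive at the vertex
  \<open>v\<close> and are scattered there into the line \<open>j\<close>.  Splitting off the last internal line gives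
  exactly the linear system \<open>(1 - \<M> S) F = \<M> e'\<close>.  For large real part of \<open>\<beta>\<close> the series
  converges by comparison with a geometric one and \<open>\<M> S\<close> is a contraction in the maximum norm, so
  \<open>det D(\<beta>) \<noteq> 0\<close> and \<open>F\<close> is given by the inverse.  Cramer's rule continues the
  inverse to the complement of the zero set, which is discrete because \<open>det D\<close> is entire and does
  not vanish identically.
\<close>

section \<open>Matrix inverses and sums over lists\<close>

text \<open>By the Leibniz formula the determinant is a polynomial in the entries.\<close>

lemma holomorphic_on_det:
  fixes A :: "complex \<Rightarrow> complex Matrix.mat"
  assumes "\<And>z. A z \<in> carrier_mat n n"
    and "\<And>i j. i < n \<Longrightarrow> j < n \<Longrightarrow> (\<lambda>z. A z $$ (i, j)) holomorphic_on S"
  shows "(\<lambda>z. Determinant.det (A z)) holomorphic_on S"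
proof -
  have "(\<lambda>z. Determinant.det (A z)) =
      (\<lambda>z. \<Sum>p\<in>{p. p permutes {0..<n}}. signof p * (\<Prod>i = 0..<n. A z $$ (i, p i)))"
    using det_def'[OF assms(1)] by auto
  moreover have "\<dots> holomorphic_on S"
    by (intro holomorphic_intros assms(2)) (auto simp: permutes_in_image)
  ultimately show ?thesis by simp
qed

lemma mat_inverse_inverts:
  fixes A :: "'a :: field Matrix.mat"
  assumes A: "A \<in> carrier_mat n n" and "Determinant.det A \<noteq> 0"
  shows "the (mat_inverse A) \<in> carrier_mat n n" "the (mat_inverse A) * A = 1\<^sub>m n"
proof -
  have "A \<in> Units (ring_mat TYPE('a) n ())"
    by (rule det_non_zero_imp_unit[OF assms])
  then obtain B where "mat_inverse A = Some B"
    using mat_inverse(1)[OF A, of "()"] by (cases "mat_inverse A") auto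
  then show "the (mat_inverse A) \<in> carrier_mat n n" "the (mat_inverse A) * A = 1\<^sub>m n"
    using mat_inverse(2)[OF A] by auto
qed

text \<open>\<open>mat_inverse\<close> comes from Gauss-Jordan elimination, whose pivoting hides how
  the result depends on the entries. Cramer's rule shows this dependence: multiplying
  \<open>A * adj_mat A = det A\<close> from the left by the inverse gives the adjugate.\<close>

lemma mat_inverse_eq_adj_mat:
  fixes A :: "'a :: field Matrix.mat"
  assumes A: "A \<in> carrier_mat n n" and det: "Determinant.det A \<noteq> 0"
  shows "the (mat_inverse A) = inverse (Determinant.det A) \<cdot>\<^sub>m adj_mat A"
proof -
  let ?B = "the (mat_inverse A)"
  note B = mat_inverse_inverts[OF assms]
  note adj = adj_mat[OF A]
  have "Determinant.det A \<cdot>\<^sub>m ?B = ?B * (A * adj_mat A)"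
    using B(1) by (simp add: adj(2) mult_smult_distrib[of _ n n "1\<^sub>m n" n])
  also have "\<dots> = adj_mat A"
    using B A adj(1) by (simp flip: assoc_mult_mat[of ?B n n A n "adj_mat A" n])
  finally have "adj_mat A = Determinant.det A \<cdot>\<^sub>m ?B" by simp
  then show ?thesis using det by (auto intro!: eq_matI)
qed

lemma holomorphic_on_mat_inverse:
  fixes A :: "complex \<Rightarrow> complex Matrix.mat"
  assumes A: "\<And>z. A z \<in> carrier_mat n n"
    and hol: "\<And>i j. i < n \<Longrightarrow> j < n \<Longrightarrow> (\<lambda>z. A z $$ (i, j)) holomorphic_on S"
    and det: "\<And>z. z \<in> S \<Longrightarrow> Determinant.det (A z) \<noteq> 0"
    and ij: "i < n" "j < n"
  shows "(\<lambda>z. the (mat_inverse (A z)) $$ (i, j)) holomorphic_on S"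
proof -
  have dim [simp]: "dim_row (A z) = n" "dim_col (A z) = n" for z
    using A[of z] by auto
  \<comment> \<open>The adjugate is the transposed cofactor matrix, so entry \<open>(i, j)\<close>
    of the inverse uses the minor without row \<open>j\<close> and column \<open>i\<close>.\<close>
  have "(\<lambda>z. inverse (Determinant.det (A z)) *
      ((-1) ^ (j + i) * Determinant.det (mat_delete (A z) j i))) holomorphic_on S"
  proof (intro holomorphic_intros holomorphic_on_det[of A n] A hol det)
    show "(\<lambda>z. Determinant.det (mat_delete (A z) j i)) holomorphic_on S"
      by (intro holomorphic_on_det[of _ "n - 1"])
        (use ij in \<open>auto simp: mat_delete_def intro!: carrier_matI hol\<close>)
  qed
  then show ?thesis
    by (rule holomorphic_transform)
      (use ij det in \<open>simp add: mat_inverse_eq_adj_mat[OF A] adj_mat_def cofactor_def\<close>)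
qed

section \<open>Sums over all words in a finite alphabet\<close>

text \<open>There are \<open>card A ^ n\<close> words of length \<open>n\<close>, so grouping by
  length bounds every finite partial sum by the geometric series with ratio
  \<open>card A * r\<close>.\<close>

lemma summable_on_lists_power_length:
  fixes r :: real
  assumes "finite A" "r \<ge> 0" "card A * r < 1"
  shows "(\<lambda>xs. r ^ length xs) summable_on lists A"
proof (rule nonneg_bdd_above_summable_on)
  let ?q = "card A * r"
  show "bdd_above (sum (\<lambda>xs. r ^ length xs) ` {F. F \<subseteq> lists A \<and> finite F})"
  proof (rule bdd_aboveI2)
    fix F assume F: "F \<in> {F. F \<subseteq> lists A \<and> finite F}"
    define L where "L n = {xs. set xs \<subseteq> A \<and> length xs = n}" for n
    have fin: "finite (L n)" for n
      unfolding L_def by (rule finite_lists_length_eq[OF assms(1)])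
    obtain N where N: "\<And>xs. xs \<in> F \<Longrightarrow> length xs < N"
      using F finite_imageI[of F length] unfolding finite_nat_set_iff_bounded by blast
    have "(\<Sum>xs\<in>F. r ^ length xs) \<le> (\<Sum>xs\<in>(\<Union>n<N. L n). r ^ length xs)"
      by (rule sum_mono2) (use F N fin assms(2) in \<open>auto simp: L_def lists_eq_set\<close>)
    also have "\<dots> = (\<Sum>n<N. \<Sum>xs\<in>L n. r ^ length xs)"
      by (rule sum.UNION_disjoint) (use fin in \<open>auto simp: L_def\<close>)
    also have "\<dots> = (\<Sum>n<N. ?q ^ n)"
    proof (rule sum.cong[OF refl])
      fix n
      have "(\<Sum>xs\<in>L n. r ^ length xs) = (\<Sum>xs\<in>L n. r ^ n)"
        by (rule sum.cong) (auto simp: L_def)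
      then show "(\<Sum>xs\<in>L n. r ^ length xs) = ?q ^ n"
        by (simp add: L_def card_lists_length_eq[OF assms(1)] power_mult_distrib)
    qed
    also have "\<dots> \<le> (\<Sum>n. ?q ^ n)"
      using assms by (intro sum_le_suminf summable_geometric) auto
    finally show "(\<Sum>xs\<in>F. r ^ length xs) \<le> (\<Sum>n. ?q ^ n)" .
  qed
qed (use assms in auto)

text \<open>The words over \<open>A\<close> are the disjoint union of the empty word and, for each
  of the finitely many first letters, a copy of all words. This self-similarity produces the linear
  system for the walk sums.\<close>

lemma has_sum_lists_rec:
  fixes f :: "'a list \<Rightarrow> 'b :: topological_comm_monoid_add"
  assumes "finite A" and "\<And>x. x \<in> A \<Longrightarrow> ((\<lambda>xs. f (x # xs)) has_sum s x) (lists A)"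
  shows "(f has_sum (f [] + (\<Sum>x\<in>A. s x))) (lists A)"
proof -
  have "(f has_sum s x) ((#) x ` lists A)" if "x \<in> A" for x
    using assms(2)[OF that] by (subst has_sum_reindex) (auto simp: o_def)
  then have "(f has_sum (\<Sum>x\<in>A. s x)) (\<Union>x\<in>A. (#) x ` lists A)"
    by (intro sum_has_sum assms(1)) auto
  then have *: "(f has_sum (f [] + (\<Sum>x\<in>A. s x))) (insert [] (\<Union>x\<in>A. (#) x ` lists A))"
    by (intro has_sum_insert) auto
  have "xs \<in> insert [] (\<Union>x\<in>A. (#) x ` lists A) \<longleftrightarrow> xs \<in> lists A" for xs
    by (cases xs) auto
  then have "insert [] (\<Union>x\<in>A. (#) x ` lists A) = lists A" by blast
  with * show ?thesis by (simp only:)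
qed

section \<open>Walks and their amplitudes\<close>

text \<open>If \<open>v\<close> is not an end of \<open>i\<close>, the value is the initial vertex;
  \<open>walk_amp\<close> uses it only when \<open>v\<close> is an end.\<close>

definition other_end :: "('v, 'l) line_graph \<Rightarrow> 'l \<Rightarrow> 'v \<Rightarrow> 'v" where
  "other_end G i v = (if v = fst (bd_int G i) then snd (bd_int G i) else fst (bd_int G i))"

text \<open>
  Unlike \<^const>\<open>walk_vertices\<close>, this lets the path start at an arbitrary vertex \<open>u\<close>, end at an
  arbitrary vertex \<open>v\<close> and be empty, so that it can be built up one internal line at a time.
\<close>

definition path_vertices ::
  "('v, 'l) line_graph \<Rightarrow> 'v \<Rightarrow> 'l list \<Rightarrow> 'v list \<Rightarrow> 'v \<Rightarrow> bool" where
  "path_vertices G u js vs v \<longleftrightarrow>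
     length vs = length js + 1 \<and> vs ! 0 = u \<and> vs ! length js = v \<and>
     (\<forall>p<length js. vs ! p \<in> int_ends G (js ! p) \<and> vs ! Suc p \<in> int_ends G (js ! p) \<and>
        vs ! p \<noteq> vs ! Suc p)"

lemma path_vertices_Nil [simp]: "path_vertices G u [] vs v \<longleftrightarrow> vs = [u] \<and> u = v"
  by (auto simp: path_vertices_def length_Suc_conv)

text \<open>Splitting off the last line of a path mirrors the recursion of \<open>walk_amp\<close>,
  which consumes the reversed list.\<close>

lemma path_vertices_snoc:
  "path_vertices G u (js @ [i]) us v \<longleftrightarrow>
     (\<exists>vs w. us = vs @ [v] \<and> path_vertices G u js vs w \<and>
        w \<in> int_ends G i \<and> v \<in> int_ends G i \<and> w \<noteq> v)"
proof
  assume L: "path_vertices G u (js @ [i]) us v"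
  let ?n = "length js"
  have us: "us = take (Suc ?n) us @ [v]"
    using L take_Suc_conv_app_nth[of "Suc ?n" us] by (auto simp: path_vertices_def)
  have "path_vertices G u js (take (Suc ?n) us) (us ! ?n)"
    unfolding path_vertices_def
  proof (intro conjI allI impI)
    fix p assume p: "p < length js"
    then have "us ! p \<in> int_ends G ((js @ [i]) ! p) \<and> us ! Suc p \<in> int_ends G ((js @ [i]) ! p) \<and>
        us ! p \<noteq> us ! Suc p"
      using L unfolding path_vertices_def by simp
    then show "take (Suc ?n) us ! p \<in> int_ends G (js ! p)"
      "take (Suc ?n) us ! Suc p \<in> int_ends G (js ! p)"
      "take (Suc ?n) us ! p \<noteq> take (Suc ?n) us ! Suc p"
      using p by (auto simp: nth_append)
  qed (use L in \<open>auto simp: path_vertices_def\<close>)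
  moreover have "us ! ?n \<in> int_ends G i" "v \<in> int_ends G i" "us ! ?n \<noteq> v"
    using L unfolding path_vertices_def by (auto dest!: spec[of _ ?n])
  ultimately show "\<exists>vs w. us = vs @ [v] \<and> path_vertices G u js vs w \<and>
        w \<in> int_ends G i \<and> v \<in> int_ends G i \<and> w \<noteq> v"
    using us by blast
next
  assume "\<exists>vs w. us = vs @ [v] \<and> path_vertices G u js vs w \<and>
        w \<in> int_ends G i \<and> v \<in> int_ends G i \<and> w \<noteq> v"
  then show "path_vertices G u (js @ [i]) us v"
    by (auto simp: path_vertices_def nth_append less_Suc_eq split: if_splits)
qed

text \<open>Both sides state the same incidences, grouped by vertex on the left and by line on the
  right. Indices shift by one because the walk starts with \<open>e'\<close>.\<close>

lemma walk_vertices_iff_path_vertices: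
  assumes "js \<noteq> []"
  shows "walk_vertices G (e' # js @ [e]) vs \<longleftrightarrow>
    path_vertices G (bd_ext G e') js vs (bd_ext G e)" (is "?L \<longleftrightarrow> ?R")
proof -
  let ?n = "length js"
  let ?w = "e' # js @ [e]"
  have n: "?n \<ge> 1" using assms by (cases js) auto
  have w: "?w ! Suc p = js ! p" if "p < ?n" for p
    using that by (simp add: nth_append)
  have w0: "?w ! 0 = e'" and wn: "?w ! Suc ?n = e" by auto
  show ?thesis
  proof
    assume ?L
    then have v: "length vs = ?n + 1" "vs ! 0 = bd_ext G e'" "vs ! 0 \<in> int_ends G (?w ! 1)"
      "vs ! ?n = bd_ext G e" "vs ! ?n \<in> int_ends G (?w ! ?n)"
      and vp: "\<And>p. p \<in> {1..?n - 1} \<Longrightarrow> vs ! p \<in> int_ends G (?w ! p) \<inter> int_ends G (?w ! (p + 1))"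
      and vd: "\<And>p. p < ?n \<Longrightarrow> vs ! p \<noteq> vs ! (p + 1)"
      unfolding walk_vertices_def by (auto simp del: nth_Cons_Suc)
    show ?R
      unfolding path_vertices_def
    proof (intro conjI allI impI)
      fix p assume p: "p < ?n"
      show "vs ! p \<in> int_ends G (js ! p)"
        using p v(3) vp[of p] w[OF p] by (cases p) auto
      show "vs ! Suc p \<in> int_ends G (js ! p)"
      proof (cases "Suc p = ?n")
        case True
        then show ?thesis using v(5) w[OF p] by metis
      next
        case False
        then show ?thesis using vp[of "Suc p"] w[OF p] p by auto
      qed
      show "vs ! p \<noteq> vs ! Suc p" using vd[OF p] by simp
    qed (use v in auto)
  next
    assume ?R
    then have v: "length vs = ?n + 1" "vs ! 0 = bd_ext G e'" "vs ! ?n = bd_ext G e"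
      and vp: "\<And>p. p < ?n \<Longrightarrow> vs ! p \<in> int_ends G (?w ! Suc p)"
        "\<And>p. p < ?n \<Longrightarrow> vs ! Suc p \<in> int_ends G (?w ! Suc p)"
        "\<And>p. p < ?n \<Longrightarrow> vs ! p \<noteq> vs ! Suc p"
      unfolding path_vertices_def by (auto simp: nth_append)
    have pred: "vs ! p \<in> int_ends G (?w ! p)" if "1 \<le> p" "p \<le> ?n" for p
      using that vp(2)[of "p - 1"] by (cases p) auto
    have "vs ! 0 \<in> int_ends G (?w ! 1)" 
      unfolding One_nat_def by (rule vp(1)) (use assms in simp)
    then show ?L
      unfolding walk_vertices_def
    proof (intro exI[of _ ?n] conjI ballI allI impI)
      fix p assume "p \<in> {1..?n - 1}"
      then have p: "1 \<le> p" "p < ?n" using n by auto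
      show "vs ! p \<in> int_ends G (?w ! p) \<inter> int_ends G (?w ! (p + 1))"
        using pred[OF p(1) less_imp_le[OF p(2)]] vp(1)[OF p(2)] unfolding Suc_eq_plus1 by blast
    next
      show "vs ! 0 = bd_ext G (?w ! 0)" using v(2) w0 by metis
      show "vs ! ?n = bd_ext G (?w ! (?n + 1))" using v(3) wn by simp
      show "vs ! ?n \<in> int_ends G (?w ! ?n)" using pred n by blast
      show "vs ! p \<noteq> vs ! (p + 1)" if "p < ?n" for p using vp(3)[OF that] by simp
    qed (use n v in auto)
  qed
qed

text \<open>
  The internal lines are listed in reverse order, the last one traversed first; lists that do not
  describe a walk from \<open>e'\<close> to \<open>v\<close> get amplitude \<open>0\<close>.
\<close>

fun walk_amp ::
  "('v, 'l) line_graph \<Rightarrow> ('l \<Rightarrow> real) \<Rightarrow> ('v \<Rightarrow> 'l \<Rightarrow> 'l \<Rightarrow> complex) \<Rightarrow> complex \<Rightarrow> 'l \<Rightarrow>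
   'v \<Rightarrow> 'l \<Rightarrow> 'l list \<Rightarrow> complex" where
  "walk_amp G a M \<beta> e' v j [] = (if v = bd_ext G e' then M v j e' else 0)"
| "walk_amp G a M \<beta> e' v j (i # js) =
     (if v \<in> int_ends G i
      then M v j i * exp (- \<beta> * of_real (a i)) * walk_amp G a M \<beta> e' (other_end G i v) i js
      else 0)"

lemma other_end_unique:
  "w \<in> int_ends G i \<Longrightarrow> v \<in> int_ends G i \<Longrightarrow> w \<noteq> v \<Longrightarrow> other_end G i v = w"
  by (auto simp: int_ends_def other_end_def)

lemma other_end_in [simp]: "other_end G i v \<in> int_ends G i"
  by (auto simp: int_ends_def other_end_def)

lemma other_end_neq: "no_tadpoles G \<Longrightarrow> i \<in> internal G \<Longrightarrow> other_end G i v \<noteq> v"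
  by (auto simp: no_tadpoles_def other_end_def)

text \<open>Since the other end of a line is unique, the recursion retraces the vertices of the path
  backwards and collects one scattering factor at each.\<close>

lemma walk_amp_eq_prod:
  assumes "path_vertices G (bd_ext G e') (rev js) vs v"
  shows "walk_amp G a M \<beta> e' v j js =
    (\<Prod>p\<le>length js. M (vs ! p) ((e' # rev js @ [j]) ! Suc p) ((e' # rev js @ [j]) ! p)) *
    exp (- \<beta> * of_real (sum_list (map a js)))"
  using assms
proof (induction js arbitrary: v j vs)
  case Nil
  then show ?case by simp
next
  case (Cons i js)
  let ?n = "length js"
  let ?w = "e' # rev js @ [i]"
  obtain us u where us: "vs = us @ [v]" "path_vertices G (bd_ext G e') (rev js) us u"
    "u \<in> int_ends G i" "v \<in> int_ends G i" "u \<noteq> v"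
    using Cons.prems by (auto simp: path_vertices_snoc)
  have len: "length us = Suc ?n" using us(2) by (simp add: path_vertices_def)
  \<comment> \<open>The two words differ only after index \<open>Suc ?n\<close>, where both still
    have the entry \<open>i\<close>.\<close>
  have w: "(e' # rev (i # js) @ [j]) ! p = ?w ! p" if "p \<le> Suc ?n" for p
    using that by (cases p) (auto simp: nth_append)
  have eq: "(\<Prod>p\<le>?n. M (vs ! p) ((e' # rev (i # js) @ [j]) ! Suc p) ((e' # rev (i # js) @ [j]) ! p)) =
      (\<Prod>p\<le>?n. M (us ! p) (?w ! Suc p) (?w ! p))"
  proof (rule prod.cong[OF refl])
    fix p assume "p \<in> {..?n}"
    then have "vs ! p = us ! p" "p \<le> Suc ?n" "Suc p \<le> Suc ?n"
      by (auto simp: us(1) len nth_append)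
    then show "M (vs ! p) ((e' # rev (i # js) @ [j]) ! Suc p) ((e' # rev (i # js) @ [j]) ! p) =
        M (us ! p) (?w ! Suc p) (?w ! p)"
      by (simp only: w)
  qed
  have "walk_amp G a M \<beta> e' v j (i # js) = M v j i * exp (- \<beta> * of_real (a i)) *
      walk_amp G a M \<beta> e' u i js"
    using us by (simp add: other_end_unique)
  also have "\<dots> = M v j i * (\<Prod>p\<le>?n. M (us ! p) (?w ! Suc p) (?w ! p)) *
      exp (- \<beta> * of_real (sum_list (map a (i # js))))"
    by (simp add: Cons.IH[OF us(2)] algebra_simps flip: exp_add)
  also have "M v j i = M (vs ! Suc ?n) ((e' # rev (i # js) @ [j]) ! Suc (Suc ?n))
      ((e' # rev (i # js) @ [j]) ! Suc ?n)"
    by (simp add: us(1) len nth_append)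
  finally show ?case
    unfolding eq[symmetric] by (simp add: mult_ac)
qed

text \<open>A nonzero amplitude passes every incidence test of the recursion; without tadpoles,
  consecutive vertices are then also distinct.\<close>

lemma walk_amp_nonzero_imp_path:
  assumes "no_tadpoles G" "set js \<subseteq> internal G" "walk_amp G a M \<beta> e' v j js \<noteq> 0"
  shows "\<exists>vs. path_vertices G (bd_ext G e') (rev js) vs v"
  using assms(2,3)
proof (induction js arbitrary: v j)
  case Nil
  then show ?case by (auto split: if_splits)
next
  case (Cons i js)
  then have v: "v \<in> int_ends G i" "walk_amp G a M \<beta> e' (other_end G i v) i js \<noteq> 0"
    by (auto split: if_splits)
  then obtain us where "path_vertices G (bd_ext G e') (rev js) us (other_end G i v)"
    using Cons.IH[OF _ v(2)] Cons.prems(1) by auto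
  then have "path_vertices G (bd_ext G e') (rev (i # js)) (us @ [v]) v"
    using v other_end_neq[OF assms(1), of i v] Cons.prems by (auto simp: path_vertices_snoc)
  then show ?case by blast
qed

section \<open>Walks and their weights in terms of paths\<close>

text \<open>Treats both kinds of walk uniformly: the trivial walk is the case of an empty
  path.\<close>

lemma walks_iff_path_vertices:
  assumes "e \<in> external G" "e' \<in> external G" "set js \<subseteq> internal G"
  shows "e' # js @ [e] \<in> walks G e e' \<longleftrightarrow>
    (\<exists>vs. path_vertices G (bd_ext G e') js vs (bd_ext G e))"
proof (cases "js = []")
  case True
  then show ?thesis
    using assms by (auto simp: walks_def nontrivial_walk_def trivial_walk_def)
next
  case False
  then show ?thesis
    using assms by (auto simp: walks_def nontrivial_walk_def trivial_walk_def
        walk_vertices_iff_path_vertices)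
qed

lemma walksE:
  assumes "w \<in> walks G e e'"
  obtains js where "js \<in> lists (internal G)" "w = e' # js @ [e]"
  using assms by (auto simp: walks_def nontrivial_walk_def trivial_walk_def lists_eq_set)

lemma walk_length_eq: "walk_length a (e' # js @ [e]) = sum_list (map a js)"
proof -
  have "walk_length a (e' # js @ [e]) = (\<Sum>p = 1..length js. a ((js @ [e]) ! (p - 1)))"
    unfolding walk_length_def by (intro sum.cong) auto
  also have "\<dots> = (\<Sum>p = 0..<length js. a (js ! p))"
    by (rule sum.reindex_bij_witness[of _ Suc "\<lambda>p. p - 1"]) (auto simp: nth_append)
  finally show ?thesis by (simp add: sum_list_sum_nth)
qed

lemma walk_weight_eq:
  assumes "path_vertices G (bd_ext G e') js vs (bd_ext G e)"
  shows "walk_weight G M (e' # js @ [e]) =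
    (\<Prod>p\<le>length js. M (vs ! p) ((e' # js @ [e]) ! Suc p) ((e' # js @ [e]) ! p))"
proof (cases "js = []")
  case True
  then show ?thesis using assms by (auto simp: walk_weight_def)
next
  case False
  let ?f = "\<lambda>p. M (vs ! p) ((e' # js @ [e]) ! Suc p) ((e' # js @ [e]) ! p)"
  from False obtain n where n: "length js = Suc n" by (cases js) auto
  have vs: "walk_vertices G (e' # js @ [e]) vs"
    using assms walk_vertices_iff_path_vertices[OF False] by blast
  \<comment> \<open>Uniqueness of the vertex sequence evaluates the definite description in the
    weight.\<close>
  have "(THE us. walk_vertices G (e' # js @ [e]) us) = vs"
    by (rule the_equality, rule vs, erule walk_vertices_unique, rule vs)
  then have "walk_weight G M (e' # js @ [e]) = ?f (Suc n) * (\<Prod>p = 1..n. ?f p) * ?f 0"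
    by (simp add: walk_weight_def n Let_def)
  also have "\<dots> = (\<Prod>p\<le>Suc n. ?f p)"
  proof -
    have "{..Suc n} = insert 0 (insert (Suc n) {1..n})" by auto
    then show ?thesis by (simp only:) (simp add: mult_ac)
  qed
  finally show ?thesis by (simp add: n)
qed

lemma walk_term_eq_walk_amp:
  assumes "path_vertices G (bd_ext G e') (rev js) vs (bd_ext G e)"
  shows "walk_term G a M \<beta> (e' # rev js @ [e]) = walk_amp G a M \<beta> e' (bd_ext G e) e js"
proof -
  have "walk_length a (e' # rev js @ [e]) = sum_list (map a js)"
    by (simp add: walk_length_eq sum_list_rev flip: rev_map)
  then show ?thesis
    by (simp only: walk_term_def walk_weight_eq[OF assms] walk_amp_eq_prod[OF assms] length_rev)
qed

text \<open>Reversal identifies walks with certain lists of internal lines, and all other lists have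
  amplitude \<open>0\<close>. Hence the sum may run over all lists, where the first-letter recursion
  is available.\<close>

lemma has_sum_walks_iff:
  assumes "no_tadpoles G" "e \<in> external G" "e' \<in> external G"
  shows "(walk_term G a M \<beta> has_sum s) (walks G e e') \<longleftrightarrow>
    (walk_amp G a M \<beta> e' (bd_ext G e) e has_sum s) (lists (internal G))"
proof -
  define S where "S = {js \<in> lists (internal G). e' # rev js @ [e] \<in> walks G e e'}"
  have path: "\<exists>vs. path_vertices G (bd_ext G e') (rev js) vs (bd_ext G e)" if "js \<in> S" for js
    using that walks_iff_path_vertices[OF assms(2,3), of "rev js"]
    by (auto simp: S_def lists_eq_set)
  have img: "walks G e e' = (\<lambda>js. e' # rev js @ [e]) ` S"
  proof (intro equalityI subsetI)
    fix w assume w: "w \<in> walks G e e'"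
    then obtain js where "js \<in> lists (internal G)" "w = e' # js @ [e]" by (rule walksE)
    then show "w \<in> (\<lambda>js. e' # rev js @ [e]) ` S"
      using w by (intro image_eqI[of _ _ "rev js"]) (auto simp: S_def)
  qed (auto simp: S_def)
  have "(walk_term G a M \<beta> has_sum s) (walks G e e') \<longleftrightarrow>
      ((\<lambda>js. walk_term G a M \<beta> (e' # rev js @ [e])) has_sum s) S"
    unfolding img by (subst has_sum_reindex) (auto simp: inj_on_def o_def)
  also have "\<dots> \<longleftrightarrow> (walk_amp G a M \<beta> e' (bd_ext G e) e has_sum s) (lists (internal G))"
  proof (rule has_sum_cong_neutral)
    fix js assume "js \<in> lists (internal G) - S"
    then show "walk_amp G a M \<beta> e' (bd_ext G e) e js = 0"
      using walk_amp_nonzero_imp_path[OF assms(1), of js a M \<beta> e' "bd_ext G e" e]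
        walks_iff_path_vertices[OF assms(2,3), of "rev js"]
      by (auto simp: S_def lists_eq_set)
  next
    fix js assume "js \<in> S \<inter> lists (internal G)"
    then show "walk_term G a M \<beta> (e' # rev js @ [e]) = walk_amp G a M \<beta> e' (bd_ext G e) e js"
      using path[of js] walk_term_eq_walk_amp[of G e' js _ e a M \<beta>] by blast
  qed (auto simp: S_def)
  finally show ?thesis .
qed

section \<open>The linear system of the walk sums\<close>

locale metric_graph =
  fixes G :: "('v, 'l) line_graph"
    and a :: "'l \<Rightarrow> real"
    and M :: "'v \<Rightarrow> 'l \<Rightarrow> 'l \<Rightarrow> complex"
    and es ls :: "'l list"
  assumes wf: "wf_graph G" and no_tadpoles: "no_tadpoles G"
    and a_pos: "\<And>i. i \<in> internal G \<Longrightarrow> a i > 0"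
    and es: "distinct es" "set es = external G"
    and ls: "distinct ls" "set ls = internal G"
begin

abbreviation "n \<equiv> length es"
abbreviation "m \<equiv> length ls"
abbreviation "d \<equiv> n + (m + m)"
abbreviation "edge \<equiv> basis_edge es ls"
abbreviation "vertex \<equiv> basis_vertex G es ls"
abbreviation "MM \<equiv> big_M G M es ls"
abbreviation "D \<equiv> D_mat G a M es ls"
abbreviation "lines \<equiv> internal G \<union> external G"

lemma edge_simps [simp]:
  "k < n \<Longrightarrow> edge k = es ! k"
  "i < m \<Longrightarrow> edge (n + i) = ls ! i"
  "i < m \<Longrightarrow> edge (n + m + i) = ls ! i"
  by (auto simp: basis_edge_def nth_append)

lemma vertex_simps [simp]:
  "k < n \<Longrightarrow> vertex k = bd_ext G (es ! k)"
  "i < m \<Longrightarrow> vertex (n + i) = fst (bd_int G (ls ! i))"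
  "i < m \<Longrightarrow> vertex (n + m + i) = snd (bd_int G (ls ! i))"
  by (auto simp: basis_vertex_def)

lemma index_cases [consumes 1, case_names ext minus plus]:
  assumes "k < d"
  obtains "k < n" | i where "i < m" "k = n + i" | i where "i < m" "k = n + m + i"
proof -
  consider "k < n" | "n \<le> k" "k < n + m" | "n + m \<le> k" by linarith
  then show ?thesis
  proof cases
    case 2
    then show ?thesis using that(2)[of "k - n"] by auto
  next
    case 3
    then show ?thesis using that(3)[of "k - (n + m)"] assms by auto
  qed (use that in auto)
qed

lemma sum_blocks:
  fixes f :: "nat \<Rightarrow> 'b :: comm_monoid_add"
  shows "(\<Sum>k<d. f k) = (\<Sum>k<n. f k) + ((\<Sum>i<m. f (n + i)) + (\<Sum>i<m. f (n + m + i)))"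
proof -
  have shift: "(\<Sum>k<p + r. f k) = (\<Sum>k<p. f k) + (\<Sum>k<r. f (p + k))" for p r
    by (induction r) (auto simp: add.assoc)
  show ?thesis using shift[of "n + m" m] shift[of n m] by (simp add: add.assoc)
qed

text \<open>The diagonal of \<open>(X + Y)/2\<close>.\<close>

definition end_factor :: "complex \<Rightarrow> nat \<Rightarrow> complex" where
  "end_factor \<beta> k = (if k < n + m then 1 else exp (\<beta> * of_real (a (edge k))))"

lemma end_factor_simps [simp]:
  "k < n \<Longrightarrow> end_factor \<beta> k = 1"
  "i < m \<Longrightarrow> end_factor \<beta> (n + i) = 1"
  "i < m \<Longrightarrow> end_factor \<beta> (n + m + i) = exp (\<beta> * of_real (a (ls ! i)))"
  by (auto simp: end_factor_def)

lemma end_factor_nonzero [simp]: "end_factor \<beta> k \<noteq> 0"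
  by (simp add: end_factor_def)

text \<open>Exchanges the indices of the two ends of an internal line; the value is meaningful only
  for indices from \<open>n\<close> on.\<close>

definition opposite :: "nat \<Rightarrow> nat" where
  "opposite k = (if k < n + m then k + m else k - m)"

lemma opposite_simps [simp]:
  "i < m \<Longrightarrow> opposite (n + i) = n + m + i"
  "i < m \<Longrightarrow> opposite (n + m + i) = n + i"
  by (auto simp: opposite_def)

lemma MM_carrier [simp]: "MM \<in> carrier_mat d d"
  by (simp add: big_M_def)

lemma X_carrier [simp]: "X_mat a es ls \<beta> \<in> carrier_mat d d"
  by (auto simp: X_mat_def Let_def exp_diag_def mat_diag_def)

lemma Y_carrier [simp]: "Y_mat a es ls \<beta> \<in> carrier_mat d d"
  by (auto simp: Y_mat_def Let_def exp_diag_def mat_diag_def)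

lemma D_carrier [simp]: "D \<beta> \<in> carrier_mat d d"
  unfolding D_mat_def
  by (intro minus_carrier_mat smult_carrier_mat mult_carrier_mat[of _ d d]
      MM_carrier X_carrier Y_carrier)

lemma D_dims [simp]: "dim_row (D \<beta>) = d" "dim_col (D \<beta>) = d"
  using carrier_matD[OF D_carrier[of \<beta>]] by simp_all

section \<open>Entries of \<open>X\<close>, \<open>Y\<close> and \<open>D\<close>\<close>

lemma four_block_index:
  fixes A B A' B' :: "complex Matrix.mat"
  assumes "A \<in> carrier_mat m m" "B \<in> carrier_mat m m" "A' \<in> carrier_mat m m" "B' \<in> carrier_mat m m"
  defines "F \<equiv> four_block_mat (1\<^sub>m n) (0\<^sub>m n (m + m)) (0\<^sub>m (m + m) n) (four_block_mat A B A' B')"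
  shows "r < n \<Longrightarrow> c < n \<Longrightarrow> F $$ (r, c) = (if r = c then 1 else 0)"
    "r < n \<Longrightarrow> i < m \<Longrightarrow> F $$ (r, n + i) = 0"
    "r < n \<Longrightarrow> i < m \<Longrightarrow> F $$ (r, n + m + i) = 0"
    "r < n \<Longrightarrow> i < m \<Longrightarrow> F $$ (n + i, r) = 0"
    "r < n \<Longrightarrow> i < m \<Longrightarrow> F $$ (n + m + i, r) = 0"
    "i < m \<Longrightarrow> j < m \<Longrightarrow> F $$ (n + i, n + j) = A $$ (i, j)"
    "i < m \<Longrightarrow> j < m \<Longrightarrow> F $$ (n + i, n + m + j) = B $$ (i, j)"
    "i < m \<Longrightarrow> j < m \<Longrightarrow> F $$ (n + m + i, n + j) = A' $$ (i, j)"
    "i < m \<Longrightarrow> j < m \<Longrightarrow> F $$ (n + m + i, n + m + j) = B' $$ (i, j)"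
  unfolding F_def using assms(1-4) by simp_all

lemma exp_diag_carrier [simp]: "exp_diag a ls s \<in> carrier_mat m m"
  by (simp add: exp_diag_def mat_diag_def)

lemma exp_diag_dims [simp]: "dim_row (exp_diag a ls s) = m" "dim_col (exp_diag a ls s) = m"
  by (simp_all add: exp_diag_def mat_diag_def)

lemma exp_diag_entry:
  "i < m \<Longrightarrow> j < m \<Longrightarrow>
    exp_diag a ls s $$ (i, j) = (if i = j then exp (s * of_real (a (ls ! j))) else 0)"
  by (simp add: exp_diag_def mat_diag_def)

lemma X_plus_Y_entry:
  assumes "h < d" "k < d"
  shows "X_mat a es ls \<beta> $$ (h, k) + Y_mat a es ls \<beta> $$ (h, k) =
    (if h = k then 2 * end_factor \<beta> k else 0)"
  using assms
  by (elim index_cases)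
    (simp_all add: X_mat_def Y_mat_def Let_def four_block_index exp_diag_entry)

text \<open>The difference is \<open>2 S E\<close>. In a column of the plus block the two
  exponentials cancel, leaving the entry \<open>2\<close> of the identity block; this form covers
  both internal blocks at once.\<close>

lemma X_minus_Y_entry:
  assumes "h < d" "k < d"
  shows "X_mat a es ls \<beta> $$ (h, k) - Y_mat a es ls \<beta> $$ (h, k) =
    (if n \<le> k \<and> h = opposite k
     then 2 * exp (- \<beta> * of_real (a (edge k))) * end_factor \<beta> k else 0)"
  using assms
  by (elim index_cases)
    (simp_all add: X_mat_def Y_mat_def Let_def four_block_index exp_diag_entry exp_minus)

text \<open>The factorization of \<open>D\<close> entry by entry: \<open>S\<close> has a single
  nonzero entry in each internal column, so the matrix product collapses to one term.\<close>

lemma D_entry: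
  assumes "h < d" "k < d"
  shows "D \<beta> $$ (h, k) = (if h = k then end_factor \<beta> k else 0) -
    (if n \<le> k then MM $$ (h, opposite k) * exp (- \<beta> * of_real (a (edge k))) * end_factor \<beta> k
     else 0)"
proof -
  let ?X = "X_mat a es ls \<beta>" and ?Y = "Y_mat a es ls \<beta>"
  have dims: "dim_row ?X = d" "dim_col ?X = d" "dim_row ?Y = d" "dim_col ?Y = d"
    "dim_row MM = d" "dim_col MM = d"
    using X_carrier[of \<beta>] Y_carrier[of \<beta>] MM_carrier by (auto simp only: carrier_matD)
  have opp: "n \<le> k \<Longrightarrow> opposite k < d"
    using assms(2) by (auto simp: opposite_def)
  have "(MM * (?X - ?Y)) $$ (h, k) = (\<Sum>l<d. MM $$ (h, l) * (?X $$ (l, k) - ?Y $$ (l, k)))"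
    using assms by (simp add: dims scalar_prod_def atLeast0LessThan)
  also have "\<dots> = (\<Sum>l<d. if l = opposite k then (if n \<le> k then MM $$ (h, l) *
      (2 * exp (- \<beta> * of_real (a (edge k))) * end_factor \<beta> k) else 0) else 0)"
    by (rule sum.cong) (auto simp: X_minus_Y_entry assms)
  also have "\<dots> = (if n \<le> k then MM $$ (h, opposite k) *
      (2 * exp (- \<beta> * of_real (a (edge k))) * end_factor \<beta> k) else 0)"
    using opp by (auto simp: sum.delta)
  finally have MXY: "(MM * (?X - ?Y)) $$ (h, k) = \<dots>" .
  have "D \<beta> $$ (h, k) = 1/2 * (?X $$ (h, k) + ?Y $$ (h, k)) - 1/2 * (MM * (?X - ?Y)) $$ (h, k)"
    using assms by (simp add: D_mat_def dims)
  then show ?thesis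
    unfolding X_plus_Y_entry[OF assms] MXY by simp
qed

text \<open>Dividing by \<open>end_factor\<close> undoes \<open>E\<close>, so this is row
  \<open>h\<close> of \<open>(1 - MM S) f\<close>, with the two ends of each internal line collected
  into one summand.\<close>

lemma D_row_sum:
  assumes "h < d"
  shows "(\<Sum>k<d. D \<beta> $$ (h, k) * (f k / end_factor \<beta> k)) =
    f h - (\<Sum>i<m. exp (- \<beta> * of_real (a (ls ! i))) *
      (MM $$ (h, n + m + i) * f (n + i) + MM $$ (h, n + i) * f (n + m + i)))"
proof -
  define g where "g k = (if n \<le> k
    then MM $$ (h, opposite k) * exp (- \<beta> * of_real (a (edge k))) * f k else 0)" for k
  have "(\<Sum>k<d. D \<beta> $$ (h, k) * (f k / end_factor \<beta> k)) =
      (\<Sum>k<d. (if k = h then f k else 0) - g k)"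
    by (rule sum.cong) (auto simp: D_entry assms g_def field_simps)
  also have "\<dots> = f h - (\<Sum>k<d. g k)"
    using assms by (simp add: sum_subtractf)
  also have "(\<Sum>k<d. g k) = (\<Sum>i<m. exp (- \<beta> * of_real (a (ls ! i))) *
      (MM $$ (h, n + m + i) * f (n + i) + MM $$ (h, n + i) * f (n + m + i)))"
    unfolding sum_blocks by (simp add: g_def distrib_left sum.distrib mult_ac)
  finally show ?thesis .
qed

lemma D_entry_holomorphic:
  assumes "h < d" "k < d"
  shows "(\<lambda>\<beta>. D \<beta> $$ (h, k)) holomorphic_on S"
proof -
  have "(\<lambda>\<beta>. end_factor \<beta> k) holomorphic_on S"
    unfolding end_factor_def by (cases "k < n + m") (auto intro!: holomorphic_intros)
  then show ?thesis
    unfolding D_entry[OF assms]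
    by (cases "h = k"; cases "n \<le> k") (auto intro!: holomorphic_intros)
qed

lemma det_D_holomorphic: "(\<lambda>\<beta>. Determinant.det (D \<beta>)) holomorphic_on S"
  by (intro holomorphic_on_det[of _ d] D_carrier D_entry_holomorphic)

lemma vertex_in: "k < d \<Longrightarrow> vertex k \<in> verts G"
  by (cases k rule: index_cases)
    (use wf ls(2) es(2) in \<open>auto simp: wf_graph_def dest!: nth_mem\<close>)

lemma edge_in: "k < d \<Longrightarrow> edge k \<in> lines"
  by (cases k rule: index_cases) (use ls(2) es(2) in \<open>auto dest!: nth_mem\<close>)

lemma other_end_in_verts: "i \<in> internal G \<Longrightarrow> other_end G i v \<in> verts G"
  using wf by (auto simp: wf_graph_def other_end_def)

lemma finite_internal: "finite (internal G)"
  using wf by (simp add: wf_graph_def)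

lemma sum_internal: "(\<Sum>i\<in>internal G. f i) = (\<Sum>k<m. f (ls ! k))"
  by (rule sum.reindex_bij_betw[OF bij_betw_nth[OF ls(1) refl ls(2)[symmetric]], symmetric])

end

text \<open>\<open>C\<close> bounds the entries of the vertex matrices and \<open>q\<close> the
  propagation factors. The factor \<open>2\<close> in \<open>small\<close> counts the two ends of
  each internal line, so that \<open>MM S\<close> contracts in the maximum norm.\<close>

locale convergent_metric_graph = metric_graph +
  fixes \<beta> :: complex and C q :: real
  assumes C: "C \<ge> 0"
    and M_bound: "\<And>v j k. v \<in> verts G \<Longrightarrow> j \<in> lines \<Longrightarrow> k \<in> lines \<Longrightarrow> norm (M v j k) \<le> C"
    and exp_bound: "\<And>i. i \<in> internal G \<Longrightarrow> norm (exp (- \<beta> * of_real (a i))) \<le> q"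
    and q: "q \<ge> 0"
    and small: "2 * m * (C * q) < 1"
begin

abbreviation "walk_sum e' v j \<equiv> infsum (walk_amp G a M \<beta> e' v j) (lists (internal G))"

text \<open>A walk with \<open>N\<close> internal lines has \<open>N\<close> propagation factors and
  \<open>N + 1\<close> scattering factors.\<close>

lemma norm_walk_amp_le:
  assumes "v \<in> verts G" "j \<in> lines" "js \<in> lists (internal G)" "e' \<in> external G"
  shows "norm (walk_amp G a M \<beta> e' v j js) \<le> C * (C * q) ^ length js"
  using assms(1-3)
proof (induction js arbitrary: v j)
  case Nil
  then show ?case using M_bound C assms(4) by auto
next
  case (Cons i js)
  then have i: "i \<in> internal G" and js: "js \<in> lists (internal G)" by auto
  have "norm (M v j i * exp (- \<beta> * of_real (a i)) * walk_amp G a M \<beta> e' (other_end G i v) i js)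
      \<le> C * q * (C * (C * q) ^ length js)"
    unfolding norm_mult
    using Cons.prems i js C q
    by (intro mult_mono M_bound exp_bound Cons.IH other_end_in_verts) auto
  then show ?case using C q by (simp add: mult_ac)
qed

lemma walk_amp_summable:
  assumes "v \<in> verts G" "j \<in> lines" "e' \<in> external G"
  shows "walk_amp G a M \<beta> e' v j summable_on lists (internal G)"
proof (rule Infinite_Sum.abs_summable_summable, rule Infinite_Sum.abs_summable_on_comparison_test')
  have "card (internal G) = m" using ls distinct_card by metis
  moreover have "0 \<le> m * (C * q)" using C q by simp
  then have "m * (C * q) < 1" using small by (simp add: mult.assoc)
  ultimately have "(\<lambda>js. (C * q) ^ length js) summable_on lists (internal G)"
    using finite_internal C q by (intro summable_on_lists_power_length) auto
  then show "(\<lambda>js. C * (C * q) ^ length js) summable_on lists (internal G)"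
    by (rule summable_on_cmult_right)
qed (use norm_walk_amp_le assms in auto)

text \<open>The head of a list is the last line traversed: the walk arrives at \<open>v\<close>
  through \<open>i\<close>, having first been scattered into \<open>i\<close> at its other
  end.\<close>

lemma walk_sum_eq:
  assumes "v \<in> verts G" "j \<in> lines" "e' \<in> external G"
  shows "walk_sum e' v j = (if v = bd_ext G e' then M v j e' else 0) +
    (\<Sum>i\<in>internal G. if v \<in> int_ends G i
       then M v j i * exp (- \<beta> * of_real (a i)) * walk_sum e' (other_end G i v) i else 0)"
proof -
  have "(walk_amp G a M \<beta> e' v j has_sum (walk_amp G a M \<beta> e' v j [] +
    (\<Sum>i\<in>internal G. if v \<in> int_ends G i
       then M v j i * exp (- \<beta> * of_real (a i)) * walk_sum e' (other_end G i v) i else 0)))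
    (lists (internal G))"
  proof (rule has_sum_lists_rec[OF finite_internal])
    fix i assume i: "i \<in> internal G"
    have "(walk_amp G a M \<beta> e' (other_end G i v) i has_sum walk_sum e' (other_end G i v) i)
        (lists (internal G))"
      using i assms by (intro has_sum_infsum walk_amp_summable other_end_in_verts) auto
    then show "((\<lambda>js. walk_amp G a M \<beta> e' v j (i # js)) has_sum (if v \<in> int_ends G i
       then M v j i * exp (- \<beta> * of_real (a i)) * walk_sum e' (other_end G i v) i else 0))
       (lists (internal G))"
      by (cases "v \<in> int_ends G i") (auto intro: has_sum_cmult_right)
  qed
  then show ?thesis by (simp add: infsumI)
qed

section \<open>Invertibility of \<open>D\<close> and the resolvent as a walk sum\<close>

lemma norm_MM_le:
  assumes "h < d" "k < d"
  shows "norm (MM $$ (h, k)) \<le> C"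
  using assms C by (auto simp: big_M_def intro!: M_bound edge_in vertex_in)

text \<open>A kernel vector would give a nonzero \<open>f\<close> with \<open>f = MM S f\<close>. At
  an index where the norm of \<open>f\<close> attains its maximum \<open>\<mu>\<close>, this yields
  \<open>\<mu> \<le> 2 * m * (C * q) * \<mu> < \<mu>\<close>.\<close>

lemma det_D_nonzero: "Determinant.det (D \<beta>) \<noteq> 0"
proof
  assume "Determinant.det (D \<beta>) = 0"
  then obtain v where v: "v \<in> carrier_vec d" "v \<noteq> 0\<^sub>v d" "D \<beta> *\<^sub>v v = 0\<^sub>v d"
    using det_0_iff_vec_prod_zero_field[OF D_carrier] by blast
  \<comment> \<open>\<open>f\<close> is \<open>E v\<close>, which brings the kernel equation into
    the form of \<open>D_row_sum\<close>.\<close>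
  define f where "f k = v $ k * end_factor \<beta> k" for k
  from v obtain k0 where k0: "k0 < d" "v $ k0 \<noteq> 0"
    by (metis carrier_vecD eq_vecI index_zero_vec)
  define \<mu> where "\<mu> = Max ((\<lambda>k. norm (f k)) ` {..<d})"
  have le: "norm (f k) \<le> \<mu>" if "k < d" for k
    unfolding \<mu>_def using that by (intro Max_ge) auto
  have "\<mu> \<in> (\<lambda>k. norm (f k)) ` {..<d}"
    unfolding \<mu>_def using k0 by (intro Max_in) auto
  then obtain h where h: "h < d" "norm (f h) = \<mu>" by auto
  have "norm (f k0) > 0" using k0(2) by (simp add: f_def)
  with le[OF k0(1)] have pos: "\<mu> > 0" by linarith
  have "0 = (D \<beta> *\<^sub>v v) $ h" using v(3) h by simp
  also have "\<dots> = (\<Sum>k<d. D \<beta> $$ (h, k) * (f k / end_factor \<beta> k))"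
    using h v(1) by (auto simp: scalar_prod_def atLeast0LessThan f_def)
  finally have fh: "f h = (\<Sum>i<m. exp (- \<beta> * of_real (a (ls ! i))) *
      (MM $$ (h, n + m + i) * f (n + i) + MM $$ (h, n + i) * f (n + m + i)))"
    unfolding D_row_sum[OF h(1)] by simp
  have "\<mu> = norm (\<Sum>i<m. exp (- \<beta> * of_real (a (ls ! i))) *
      (MM $$ (h, n + m + i) * f (n + i) + MM $$ (h, n + i) * f (n + m + i)))"
    unfolding h(2)[symmetric] by (rule arg_cong[OF fh])
  also have "\<dots> \<le> (\<Sum>i<m. q * (C * \<mu> + C * \<mu>))"
  proof (rule order.trans[OF norm_sum sum_mono])
    fix i assume "i \<in> {..<m}"
    then have i: "i < m" by simp
    have "norm (exp (- \<beta> * of_real (a (ls ! i)))) \<le> q"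
      using nth_mem[OF i] unfolding ls(2) by (rule exp_bound)
    moreover have "norm (MM $$ (h, n + m + i) * f (n + i) + MM $$ (h, n + i) * f (n + m + i)) \<le>
        C * \<mu> + C * \<mu>"
    proof (rule order.trans[OF norm_triangle_ineq add_mono])
      show "norm (MM $$ (h, n + m + i) * f (n + i)) \<le> C * \<mu>"
        "norm (MM $$ (h, n + i) * f (n + m + i)) \<le> C * \<mu>"
        unfolding norm_mult
        using norm_MM_le[OF h(1), of "n + m + i"] norm_MM_le[OF h(1), of "n + i"]
          le[of "n + i"] le[of "n + m + i"] i C
        by (auto intro!: mult_mono)
    qed
    ultimately show "norm (exp (- \<beta> * of_real (a (ls ! i))) *
        (MM $$ (h, n + m + i) * f (n + i) + MM $$ (h, n + i) * f (n + m + i))) \<le>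
        q * (C * \<mu> + C * \<mu>)"
      by (subst norm_mult, intro mult_mono) (use q in auto)
  qed
  also have "\<dots> = 2 * m * (C * q) * \<mu>" by (simp add: algebra_simps)
  also have "\<dots> < 1 * \<mu>" using small pos by (intro mult_strict_right_mono) auto
  finally show False by simp
qed

text \<open>The walk sums at all basis vectors form a vector \<open>f\<close> with
  \<open>(1 - MM S) f\<close> equal to column \<open>c\<close> of \<open>MM\<close>. So
  \<open>u\<close>, which is \<open>f\<close> with \<open>E\<close> divided out, solves
  \<open>D u = col MM c\<close>, and applying the inverse gives \<open>u\<close>.\<close>

lemma resolvent_eq_walk_sum:
  assumes r: "r < n" and c: "c < n"
  shows "(the (mat_inverse (D \<beta>)) * MM) $$ (r, c) =
    walk_sum (es ! c) (bd_ext G (es ! r)) (es ! r)"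
proof -
  let ?B = "the (mat_inverse (D \<beta>))"
  let ?e' = "es ! c"
  define f where "f k = walk_sum ?e' (vertex k) (edge k)" for k
  define u where "u = Matrix.vec d (\<lambda>k. f k / end_factor \<beta> k)"
  note B = mat_inverse_inverts[OF D_carrier det_D_nonzero]
  have u: "u \<in> carrier_vec d" by (simp add: u_def)
  have e': "?e' \<in> external G" using nth_mem[OF c] unfolding es(2) .
  have Du: "D \<beta> *\<^sub>v u = col MM c"
  proof (rule eq_vecI)
    fix h assume "h < dim_vec (col MM c)"
    then have h: "h < d" by (simp add: big_M_def)
    let ?v = "vertex h"
    have "f h = (if ?v = bd_ext G ?e' then M ?v (edge h) ?e' else 0) +
        (\<Sum>k<m. if ?v \<in> int_ends G (ls ! k) then M ?v (edge h) (ls ! k) *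
          exp (- \<beta> * of_real (a (ls ! k))) * walk_sum ?e' (other_end G (ls ! k) ?v) (ls ! k) else 0)"
      unfolding f_def walk_sum_eq[OF vertex_in[OF h] edge_in[OF h] e'] sum_internal ..
    also have "(if ?v = bd_ext G ?e' then M ?v (edge h) ?e' else 0) = MM $$ (h, c)"
      using h c by (simp add: big_M_def)
    also have "(\<Sum>k<m. if ?v \<in> int_ends G (ls ! k) then M ?v (edge h) (ls ! k) *
          exp (- \<beta> * of_real (a (ls ! k))) * walk_sum ?e' (other_end G (ls ! k) ?v) (ls ! k) else 0)
        = (\<Sum>i<m. exp (- \<beta> * of_real (a (ls ! i))) *
      (MM $$ (h, n + m + i) * f (n + i) + MM $$ (h, n + i) * f (n + m + i)))"
    proof (rule sum.cong[OF refl])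
      fix i assume "i \<in> {..<m}"
      then have i: "i < m" by simp
      \<comment> \<open>Without tadpoles at most one end of the line lies at the vertex of
        \<open>h\<close>, so at most one of the two terms survives.\<close>
      then have ne: "fst (bd_int G (ls ! i)) \<noteq> snd (bd_int G (ls ! i))"
        using no_tadpoles ls(2) nth_mem[OF i] unfolding no_tadpoles_def by blast
      have "MM $$ (h, n + m + i) = (if ?v = snd (bd_int G (ls ! i)) then M ?v (edge h) (ls ! i) else 0)"
        "MM $$ (h, n + i) = (if ?v = fst (bd_int G (ls ! i)) then M ?v (edge h) (ls ! i) else 0)"
        using h i by (simp_all add: big_M_def)
      note MM_eq = this
      have f_eq: "f (n + i) = walk_sum ?e' (fst (bd_int G (ls ! i))) (ls ! i)"
        "f (n + m + i) = walk_sum ?e' (snd (bd_int G (ls ! i))) (ls ! i)"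
        using i by (simp_all add: f_def)
      show "(if ?v \<in> int_ends G (ls ! i) then M ?v (edge h) (ls ! i) *
          exp (- \<beta> * of_real (a (ls ! i))) * walk_sum ?e' (other_end G (ls ! i) ?v) (ls ! i) else 0)
        = exp (- \<beta> * of_real (a (ls ! i))) *
          (MM $$ (h, n + m + i) * f (n + i) + MM $$ (h, n + i) * f (n + m + i))"
      proof (cases "?v = fst (bd_int G (ls ! i))")
        case True
        then show ?thesis using ne unfolding MM_eq f_eq by (simp add: int_ends_def other_end_def)
      next
        case False
        then show ?thesis unfolding MM_eq f_eq by (simp add: int_ends_def other_end_def)
      qed
    qed
    finally have "MM $$ (h, c) = (\<Sum>k<d. D \<beta> $$ (h, k) * (f k / end_factor \<beta> k))"
      unfolding D_row_sum[OF h] by simp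
    then show "(D \<beta> *\<^sub>v u) $ h = col MM c $ h"
      using h c carrier_matD[OF MM_carrier] by (simp add: scalar_prod_def atLeast0LessThan u_def)
  qed (simp add: big_M_def)
  have "(?B * MM) $$ (r, c) = (?B *\<^sub>v col MM c) $ r"
    using carrier_matD[OF B(1)] carrier_matD[OF MM_carrier] r c by simp
  also have "col MM c = D \<beta> *\<^sub>v u" by (rule Du[symmetric])
  also have "?B *\<^sub>v (D \<beta> *\<^sub>v u) = u"
    unfolding assoc_mult_mat_vec[OF B(1) D_carrier u, symmetric] B(2) using u by simp
  \<comment> \<open>For \<open>r < n\<close> the factor \<open>end_factor\<close> is
    \<open>1\<close>, so \<open>u\<close> and \<open>f\<close> agree there.\<close>
  finally show ?thesis using r by (simp add: u_def f_def)
qed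

end

section \<open>Analytic continuation\<close>

context metric_graph
begin

lemma convergent_if_Re_large:
  "\<exists>\<sigma> C q. \<forall>\<beta>. Re \<beta> > \<sigma> \<longrightarrow> convergent_metric_graph G a M es ls \<beta> C q"
proof -
  let ?S = "(\<lambda>(v, j, k). norm (M v j k)) ` (verts G \<times> lines \<times> lines)"
  have fin: "finite ?S"
    using wf by (auto simp: wf_graph_def)
  \<comment> \<open>Inserting \<open>0\<close> here and \<open>1\<close> below makes both sets
    nonempty and forces the right sign, also when there are no internal lines.\<close>
  define C where "C = Max (insert 0 ?S)"
  have C: "C \<ge> 0" unfolding C_def using fin by (intro Max_ge) auto
  have M_bound: "norm (M v j k) \<le> C" if "v \<in> verts G" "j \<in> lines" "k \<in> lines" for v j k
    unfolding C_def using fin that by (intro Max_ge) force+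
  define \<alpha> where "\<alpha> = Min (insert 1 (a ` internal G))"
  have \<alpha>_pos: "\<alpha> > 0" unfolding \<alpha>_def using finite_internal a_pos by (subst Min_gr_iff) auto
  have \<alpha>_le: "\<alpha> \<le> a i" if "i \<in> internal G" for i
    unfolding \<alpha>_def using finite_internal that by (intro Min_le) auto
  \<comment> \<open>With \<open>q = 1 / K\<close> the contraction constant is
    \<open>(K - 1) / K < 1\<close>. The bound \<open>ln K / \<alpha>\<close> on the real part makes
    every propagation factor at most \<open>1 / K\<close>.\<close>
  define K where "K = 2 * m * C + 1"
  have K: "K \<ge> 1" using C by (simp add: K_def)
  define q where "q = inverse K"
  show ?thesis
  proof (intro exI allI impI)
    fix \<beta> assume \<beta>: "Re \<beta> > ln K / \<alpha>"
    show "convergent_metric_graph G a M es ls \<beta> C q"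
    proof unfold_locales
      fix i assume i: "i \<in> internal G"
      \<comment> \<open>The sign is needed to multiply \<open>\<alpha> \<le> a i\<close> by
        \<open>Re \<beta>\<close>.\<close>
      have "0 \<le> Re \<beta>" 
        using \<beta> divide_nonneg_pos[OF ln_ge_zero[OF K] \<alpha>_pos] by linarith
      then have "ln K \<le> Re \<beta> * a i"
        using \<beta> \<alpha>_pos \<alpha>_le[OF i] mult_left_mono[of \<alpha> "a i" "Re \<beta>"]
        by (simp add: pos_divide_less_eq)
      then have "exp (- (Re \<beta> * a i)) \<le> exp (- ln K)" by simp
      also have "\<dots> = q" using K by (simp add: exp_minus q_def)
      finally show "norm (exp (- \<beta> * of_real (a i))) \<le> q" by simp
    next
      show "2 * m * (C * q) < 1" using K by (simp add: q_def K_def field_simps)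
    qed (use C K M_bound in \<open>auto simp: q_def\<close>)
  qed
qed

section \<open>Compression to the external block and holomorphy of the resolvent\<close>

lemma ext_column_carrier: "ext_column es ls \<in> carrier_mat d n"
  unfolding ext_column_def by (intro carrier_append_rows) auto

lemma ext_column_entry:
  assumes "k < d" "c < n"
  shows "ext_column es ls $$ (k, c) = (if k = c then 1 else 0)"
  using assms by (auto simp: ext_column_def append_rows_def)

lemma ext_compression_entry:
  assumes A: "A \<in> carrier_mat d d" and rc: "r < n" "c < n"
  shows "(transpose_mat (ext_column es ls) * A * ext_column es ls) $$ (r, c) = A $$ (r, c)"
proof -
  let ?P = "ext_column es ls"
  have dims: "dim_row ?P = d" "dim_col ?P = n" "dim_row A = d" "dim_col A = d"
    using ext_column_carrier A by auto
  have TA: "(transpose_mat ?P * A) $$ (r, k) = A $$ (r, k)" if k: "k < d" for k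
  proof -
    have "(transpose_mat ?P * A) $$ (r, k) = (\<Sum>l<d. ?P $$ (l, r) * A $$ (l, k))"
      using rc k by (simp add: dims scalar_prod_def atLeast0LessThan)
    also have "\<dots> = (\<Sum>l<d. if l = r then A $$ (l, k) else 0)"
      by (rule sum.cong) (auto simp: ext_column_entry rc)
    finally show ?thesis using rc by simp
  qed
  have "(transpose_mat ?P * A * ?P) $$ (r, c) =
      (\<Sum>k<d. (transpose_mat ?P * A) $$ (r, k) * ?P $$ (k, c))"
    using rc by (subst index_mult_mat(1)) (auto simp: dims scalar_prod_def atLeast0LessThan)
  also have "\<dots> = (\<Sum>k<d. if k = c then A $$ (r, k) else 0)"
    by (rule sum.cong) (auto simp: ext_column_entry rc TA simp del: index_mult_mat)
  finally show ?thesis using rc by simp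
qed

lemma resolvent_carrier:
  assumes "Determinant.det (D \<beta>) \<noteq> 0"
  shows "the (mat_inverse (D \<beta>)) * MM \<in> carrier_mat d d"
  using mat_inverse_inverts(1)[OF D_carrier assms] by (rule mult_carrier_mat) (rule MM_carrier)

lemma resolvent_holomorphic:
  assumes "i < d" "j < d" and "\<And>\<beta>. \<beta> \<in> S \<Longrightarrow> Determinant.det (D \<beta>) \<noteq> 0"
  shows "(\<lambda>\<beta>. (the (mat_inverse (D \<beta>)) * MM) $$ (i, j)) holomorphic_on S"
proof -
  have "(\<lambda>\<beta>. \<Sum>k<d. the (mat_inverse (D \<beta>)) $$ (i, k) * MM $$ (k, j)) holomorphic_on S"
    by (intro holomorphic_intros holomorphic_on_mat_inverse[of _ d] D_carrier
        D_entry_holomorphic assms) auto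
  then show ?thesis
  proof (rule holomorphic_transform)
    \<comment> \<open>The entry formula for the product needs the dimensions of the inverse, known
      where the determinant is nonzero.\<close>
    fix \<beta> assume "\<beta> \<in> S"
    then have "the (mat_inverse (D \<beta>)) \<in> carrier_mat d d"
      using mat_inverse_inverts(1)[OF D_carrier] assms(3) by blast
    then show "(\<Sum>k<d. the (mat_inverse (D \<beta>)) $$ (i, k) * MM $$ (k, j)) =
        (the (mat_inverse (D \<beta>)) * MM) $$ (i, j)"
      using assms(1,2) carrier_matD[OF MM_carrier] by (simp add: scalar_prod_def atLeast0LessThan)
  qed
qed

text \<open>By the identity theorem a limit point of zeros would make the entire function
  \<open>det D\<close> vanish identically, although it is nonzero far to the right.\<close>

lemma zero_set_discrete: "\<not> z islimpt zero_set G a M es ls"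
proof
  assume lim: "z islimpt zero_set G a M es ls"
  have zero: "Determinant.det (D w) = 0" for w
    by (rule analytic_continuation[OF det_D_holomorphic[of UNIV] _ _ _ _
          lim])
      (auto simp: zero_set_def)
  obtain \<sigma> C q where conv: "\<And>\<beta>. Re \<beta> > \<sigma> \<Longrightarrow> convergent_metric_graph G a M es ls \<beta> C q"
    using convergent_if_Re_large by blast
  show False
    using convergent_metric_graph.det_D_nonzero[OF conv[of "of_real (\<sigma> + 1)"]] zero by simp
qed

end

theorem theorem6p2:
  fixes G :: "('v, 'l) line_graph"
    and a :: "'l \<Rightarrow> real"
    and M :: "'v \<Rightarrow> 'l \<Rightarrow> 'l \<Rightarrow> complex"
    and es ls :: "'l list"
  assumes "wf_graph G" and "connected_graph G" and "noncompact_graph G" and "no_tadpoles G"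
    and "\<forall>i\<in>internal G. a i > 0"
    and "distinct es" and "set es = external G"
    and "distinct ls" and "set ls = internal G"
  shows "(\<lambda>\<beta>. Determinant.det (D_mat G a M es ls \<beta>)) holomorphic_on UNIV \<and>
    (\<forall>z. \<not> z islimpt zero_set G a M es ls) \<and>
    (\<exists>T :: 'l \<Rightarrow> 'l \<Rightarrow> complex \<Rightarrow> complex.
      (\<exists>\<sigma>::real. \<forall>\<beta>. Re \<beta> > \<sigma> \<longrightarrow>
         \<beta> \<notin> zero_set G a M es ls \<and>
         (\<forall>e\<in>external G. \<forall>e'\<in>external G.
            (walk_term G a M \<beta> has_sum T e e' \<beta>) (walks G e e'))) \<and>
      (\<forall>e\<in>external G. \<forall>e'\<in>external G. T e e' analytic_on - zero_set G a M es ls) \<and>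
      (\<forall>\<beta>\<in>- zero_set G a M es ls.
         Matrix.mat (length es) (length es) (\<lambda>(r, c). T (es ! r) (es ! c) \<beta>) =
         transpose_mat (ext_column es ls) * the (mat_inverse (D_mat G a M es ls \<beta>)) *
         big_M G M es ls * ext_column es ls))"
proof -
  interpret metric_graph G a M es ls
    using assms by unfold_locales auto
  let ?Z = "zero_set G a M es ls"
  let ?P = "ext_column es ls"
  \<comment> \<open>Translates an external line into its position in the enumeration
    \<open>es\<close>.\<close>
  define idx where "idx = inv_into {..<n} ((!) es)"
  have idx: "idx e < n" "es ! idx e = e" if "e \<in> external G" for e
  proof -
    have "e \<in> (!) es ` {..<n}" using that unfolding es(2)[symmetric] set_conv_nth by auto
    then show "idx e < n" "es ! idx e = e"
      unfolding idx_def
      using inv_into_into[of e "(!) es" "{..<n}"] f_inv_into_f[of e "(!) es" "{..<n}"] by auto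
  qed
  have idx_nth: "idx (es ! r) = r" if "r < n" for r
    unfolding idx_def using that inj_on_nth[OF es(1), of "{..<n}"] by (intro inv_into_f_f) auto
  \<comment> \<open>The continuation is read off from the resolvent for every \<open>\<beta>\<close>
    and identified with the series only for large real part; on the zero set its value is
    unspecified.\<close>
  define T where "T e e' \<beta> = (the (mat_inverse (D \<beta>)) * MM) $$ (idx e, idx e')" for e e' \<beta>
  obtain \<sigma> C q where conv: "\<And>\<beta>. Re \<beta> > \<sigma> \<Longrightarrow> convergent_metric_graph G a M es ls \<beta> C q"
    using convergent_if_Re_large by blast
  have det: "Determinant.det (D \<beta>) \<noteq> 0" if "\<beta> \<in> - ?Z" for \<beta>
    using that by (simp add: zero_set_def)
  have "\<beta> \<notin> ?Z" if "Re \<beta> > \<sigma>" for \<beta>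
    using convergent_metric_graph.det_D_nonzero[OF conv[OF that]] by (simp add: zero_set_def)
  moreover have "(walk_term G a M \<beta> has_sum T e e' \<beta>) (walks G e e')"
    if "Re \<beta> > \<sigma>" and e: "e \<in> external G" "e' \<in> external G" for \<beta> e e'
  proof -
    interpret convergent_metric_graph G a M es ls \<beta> C q by (rule conv[OF that(1)])
    have "T e e' \<beta> = walk_sum e' (bd_ext G e) e"
      unfolding T_def by (simp add: resolvent_eq_walk_sum idx e)
    moreover have "bd_ext G e \<in> verts G" using e wf by (auto simp: wf_graph_def)
    ultimately show ?thesis
      unfolding has_sum_walks_iff[OF no_tadpoles e]
      using has_sum_infsum[OF walk_amp_summable[OF _ UnI2[OF e(1)] e(2)]] by simp
  qed
  moreover have "T e e' analytic_on - ?Z" if "e \<in> external G" "e' \<in> external G" for e e'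
  proof -
    \<comment> \<open>A set without limit points is closed; on its open complement holomorphic and
      analytic coincide.\<close>
    have "open (- ?Z)"
      using zero_set_discrete closed_limpt by blast
    moreover have "T e e' holomorphic_on - ?Z"
      unfolding T_def using idx(1)[OF that(1)] idx(1)[OF that(2)] det
      by (intro resolvent_holomorphic) auto
    ultimately show ?thesis by (simp add: analytic_on_open)
  qed
  moreover have "Matrix.mat n n (\<lambda>(r, c). T (es ! r) (es ! c) \<beta>) =
      transpose_mat ?P * the (mat_inverse (D \<beta>)) * MM * ?P" if "\<beta> \<in> - ?Z" for \<beta>
  proof -
    note B = mat_inverse_inverts(1)[OF D_carrier det[OF that]]
    have P: "transpose_mat ?P \<in> carrier_mat n d" using ext_column_carrier by simp
    have "transpose_mat ?P * the (mat_inverse (D \<beta>)) * MM * ?P =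
        transpose_mat ?P * (the (mat_inverse (D \<beta>)) * MM) * ?P"
      by (simp only: assoc_mult_mat[OF P B MM_carrier])
    also have "\<dots> = Matrix.mat n n (\<lambda>(r, c). T (es ! r) (es ! c) \<beta>)"
    proof (rule eq_matI)
      fix r c assume "r < dim_row (Matrix.mat n n (\<lambda>(r, c). T (es ! r) (es ! c) \<beta>))"
        "c < dim_col (Matrix.mat n n (\<lambda>(r, c). T (es ! r) (es ! c) \<beta>))"
      then have "r < n" "c < n" by auto
      then show "(transpose_mat ?P * (the (mat_inverse (D \<beta>)) * MM) * ?P) $$ (r, c) =
          Matrix.mat n n (\<lambda>(r, c). T (es ! r) (es ! c) \<beta>) $$ (r, c)"
        unfolding ext_compression_entry[OF resolvent_carrier[OF det[OF that]] \<open>r < n\<close> \<open>c < n\<close>]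
        by (simp add: T_def idx_nth)
    qed (use ext_column_carrier in simp_all)
    finally show ?thesis by simp
  qed
  ultimately show ?thesis
    using det_D_holomorphic zero_set_discrete
    by (intro conjI exI[of _ T] exI[of _ \<sigma>] allI impI ballI)
qed

end
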